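(* Let $X$ be a finite set of alternatives with $|X|=m\geq 3$ and let $N=\{1,\dots,n\}$ with $n\geq 2$. Let $G_T$ be the top cycle correspondence on $L(X)^N$. (1) If $n$ is odd, then every one-element subset of $X$ is in the range of $G_T$, no two-element subset of $X$ is in the range of $G_T$, and every subset of $X$ with three or more elements is in the range of $G_T$. (2) If $n$ is even, then every non-empty subset of $X$ is in the range of $G_T$.
   Context: $L(X)$ is the set of strong orderings on $X$: complete (any two distinct alternatives are comparable), asymmetric, transitive relations. A profile is $u=(u(1),\dots,u(n))\in L(X)^N$; $x\succ_{u(i)}y$ means $x$ ranks above $y$ in $u(i)$. The simple majority voting relation at $u$ is: $x\succsim_u y$ if and only if $|\{i: x\succ_{u(i)}y\}|\geq|\{i: y\succ_{u(i)}x\}|$. Let $R(u)$ be the transitive closure of $\succsim_u$. The top cycle correspondence is $G_T(u)=\{x\in X: xR(u)y\text{ for all }y\in X\}$. A set $S$ is in the range of $G_T$ if $G_T(u)=S$ for some profile $u\in L(X)^N$. *)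

theory Defs
  imports Main "HOL-Library.FuncSet"
begin

(* A pair (x, y) in an ordering means that x ranks above y. *)
definition strong_orderings :: "'a set \<Rightarrow> 'a rel set" where
  "strong_orderings X =
     {r. r \<subseteq> X \<times> X \<and> total_on X r \<and> asym r \<and> trans r}"

definition profiles :: "'a set \<Rightarrow> nat \<Rightarrow> (nat \<Rightarrow> 'a rel) set" where
  "profiles X n = {1..n} \<rightarrow>\<^sub>E strong_orderings X"

definition majority_relation :: "'a set \<Rightarrow> nat \<Rightarrow> (nat \<Rightarrow> 'a rel) \<Rightarrow> 'a rel" where
  "majority_relation X n u =
     {(x, y). x \<in> X \<and> y \<in> X \<and>
        card {i \<in> {1..n}. (x, y) \<in> u i} \<ge> card {i \<in> {1..n}. (y, x) \<in> u i}}"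

definition top_cycle :: "'a set \<Rightarrow> nat \<Rightarrow> (nat \<Rightarrow> 'a rel) \<Rightarrow> 'a set" where
  "top_cycle X n u = {x \<in> X. \<forall>y \<in> X. (x, y) \<in> (majority_relation X n u)\<^sup>+}"

definition top_cycle_range :: "'a set \<Rightarrow> nat \<Rightarrow> 'a set set" where
  "top_cycle_range X n = top_cycle X n ` profiles X n"

end

theory Submission
  imports Defs
begin

text \<open>
  Membership of a set \<open>S\<close> in the range is obtained from profiles in which every voter
  ranks all of \<open>S\<close> above all of \<open>X - S\<close>: then no majority path leads
  from outside into \<open>S\<close>, so the top cycle is exactly \<open>S\<close> as soon as the majority relation
  connects \<open>S\<close> internally (\<open>top_cycle_eqI\<close>). It remains to choose the restrictions to \<open>S\<close>.

  \<^item> A singleton needs nothing, so a unanimous profile works.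
  \<^item> If \<open>n\<close> is even, one half of the voters uses some ordering of \<open>S\<close> and the other half its
    reverse. All alternatives in \<open>S\<close> are then tied.
  \<^item> If \<open>n = 2 * k + 1\<close> with \<open>k > 0\<close> and \<open>S\<close> has at least three elements, pick \<open>a \<noteq> b\<close> in \<open>S\<close> and
    let \<open>C = S - {a, b}\<close>. With \<open>k\<close> voters ranking the blocks as \<open>a, b, C\<close>, another \<open>k\<close> as
    \<open>C, a, b\<close> and one as \<open>b, C, a\<close>, any two of the three types form a majority. This is a
    Condorcet cycle of blocks: \<open>a\<close> beats \<open>b\<close>, \<open>b\<close> beats each element of \<open>C\<close>,
    and each of these beats \<open>a\<close>. Since \<open>C\<close> is nonempty, \<open>S\<close> is connected.

  For odd \<open>n\<close> no ties occur between distinct alternatives, so if the top cycle were \<open>{x, y}\<close>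
  one of the two, say \<open>x\<close>, would strictly beat the other. Everything that weakly beats a member
  of the top cycle belongs to the top cycle; hence nothing but \<open>x\<close> weakly beats \<open>x\<close>, and no path
  leads from \<open>y\<close> to \<open>x\<close> (\<open>top_cycle_not_pair\<close>).
\<close>

section \<open>Orderings and majorities\<close>

text \<open>The tie breaker \<open>e\<close> is integer valued so that negating it reverses every block while
  the order of the blocks is kept.\<close>
definition block_order :: "'a set \<Rightarrow> ('a \<Rightarrow> nat) \<Rightarrow> ('a \<Rightarrow> int) \<Rightarrow> 'a rel" where
  "block_order X p e =
     {(x, y). x \<in> X \<and> y \<in> X \<and> (p x < p y \<or> p x = p y \<and> e x < e y)}"

lemma block_order_strong:
  assumes "inj_on e X"
  shows "block_order X p e \<in> strong_orderings X"
proof -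
  have "total_on X (block_order X p e)"
    using assms by (auto simp: total_on_def block_order_def inj_on_def linorder_not_less
        order.order_iff_strict)
  moreover have "asym (block_order X p e)"
    by (rule asymI) (auto simp: block_order_def)
  moreover have "trans (block_order X p e)"
    by (rule transI) (auto simp: block_order_def)
  ultimately show ?thesis
    by (auto simp: strong_orderings_def block_order_def)
qed

lemma finite_imp_int_inj:
  assumes "finite X"
  obtains e :: "'a \<Rightarrow> int" where "inj_on e X"
proof -
  obtain f :: "'a \<Rightarrow> nat" where "inj_on f X"
    using finite_imp_inj_to_nat_seg[OF assms] by auto
  then have "inj_on (\<lambda>x. int (f x)) X" by (simp add: inj_on_def)
  then show ?thesis by (rule that)
qed

lemma profile_strong:
  "u \<in> profiles X n \<Longrightarrow> i \<in> {1..n} \<Longrightarrow> u i \<in> strong_orderings X"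
  by (auto simp: profiles_def)

lemma vote_not_sym:
  assumes "u \<in> profiles X n" "i \<in> {1..n}" "(x, y) \<in> u i"
  shows "(y, x) \<notin> u i"
proof -
  have "asym (u i)" using profile_strong[OF assms(1,2)] by (simp add: strong_orderings_def)
  then show ?thesis using assms(3) by (rule asymD)
qed

lemma restrict_in_profiles:
  assumes "\<And>i. i \<in> {1..n} \<Longrightarrow> f i \<in> strong_orderings X"
  shows "restrict f {1..n} \<in> profiles X n"
  using assms by (auto simp: profiles_def)

text \<open>No voter holds both opinions on a pair, so half of the voters suffice for a weak
  majority.\<close>
lemma majorityI:
  assumes u: "u \<in> profiles X n" and xy: "x \<in> X" "y \<in> X"
    and B: "B \<subseteq> {1..n}" "\<And>i. i \<in> B \<Longrightarrow> (x, y) \<in> u i" and n: "n \<le> 2 * card B"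
  shows "(x, y) \<in> majority_relation X n u"
proof -
  let ?P = "{i \<in> {1..n}. (x, y) \<in> u i}" and ?Q = "{i \<in> {1..n}. (y, x) \<in> u i}"
  have "?P \<inter> ?Q = {}"
    using vote_not_sym[OF u] by blast
  then have "card ?P + card ?Q = card (?P \<union> ?Q)"
    by (subst card_Un_disjoint) auto
  also have "\<dots> \<le> card {1..n}" by (rule card_mono) auto
  finally have "card ?P + card ?Q \<le> n" by simp
  moreover have "card B \<le> card ?P" by (rule card_mono) (use B in auto)
  ultimately show ?thesis using n xy by (simp add: majority_relation_def)
qed

lemma majority_reflexive: "x \<in> X \<Longrightarrow> (x, x) \<in> majority_relation X n u"
  by (simp add: majority_relation_def)

text \<open>Each voter supports exactly one of two distinct alternatives, and an odd number of voters
  does not split evenly.\<close>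
lemma odd_majority_antisym:
  assumes u: "u \<in> profiles X n" and "odd n" and "x \<in> X" "y \<in> X" "x \<noteq> y"
    and "(x, y) \<in> majority_relation X n u"
  shows "(y, x) \<notin> majority_relation X n u"
proof
  assume "(y, x) \<in> majority_relation X n u"
  let ?P = "{i \<in> {1..n}. (x, y) \<in> u i}" and ?Q = "{i \<in> {1..n}. (y, x) \<in> u i}"
  have eq: "card ?P = card ?Q"
    using assms(6) \<open>(y, x) \<in> majority_relation X n u\<close> by (simp add: majority_relation_def)
  have "?P \<inter> ?Q = {}"
    using vote_not_sym[OF u] by blast
  then have "card ?P + card ?Q = card (?P \<union> ?Q)"
    by (subst card_Un_disjoint) auto
  also have "?P \<union> ?Q = {1..n}"
  proof -
    have "(x, y) \<in> u i \<or> (y, x) \<in> u i" if "i \<in> {1..n}" for i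
      using profile_strong[OF u that] assms(3-5)
      by (auto simp: strong_orderings_def total_on_def)
    then show ?thesis by blast
  qed
  finally have "card ?P + card ?Q = n" by simp
  with eq have "n = 2 * card ?Q" by simp
  then show False using \<open>odd n\<close> by (metis dvd_triv_left)
qed

section \<open>Recognising top cycles\<close>

text \<open>Unanimity gives every member of \<open>S\<close> a direct majority step to each outsider and
  leaves no majority step back, hence by induction no path back.\<close>
lemma top_cycle_eqI:
  assumes u: "u \<in> profiles X n" and "n > 0" and "S \<subseteq> X" "S \<noteq> {}"
    and above: "\<And>i x y. i \<in> {1..n} \<Longrightarrow> x \<in> S \<Longrightarrow> y \<in> X - S \<Longrightarrow> (x, y) \<in> u i"
    and conn: "\<And>x y. x \<in> S \<Longrightarrow> y \<in> S \<Longrightarrow> (x, y) \<in> (majority_relation X n u)\<^sup>+"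
  shows "top_cycle X n u = S"
proof -
  let ?M = "majority_relation X n u"
  have down: "(x, y) \<in> ?M" if "x \<in> S" "y \<in> X - S" for x y
    using majorityI[OF u, of x y "{1..n}"] above that \<open>S \<subseteq> X\<close> by auto
  have no_up: "x \<notin> S" if "(y, x) \<in> ?M" "y \<notin> S" for x y
  proof
    assume "x \<in> S"
    have "y \<in> X" using that by (simp add: majority_relation_def)
    have xy: "(x, y) \<in> u i" if "i \<in> {1..n}" for i
      using above that \<open>x \<in> S\<close> \<open>y \<in> X\<close> \<open>y \<notin> S\<close> by blast
    have P: "{i \<in> {1..n}. (x, y) \<in> u i} = {1..n}"
      using xy by blast
    have Q: "{i \<in> {1..n}. (y, x) \<in> u i} = {}"
      using xy vote_not_sym[OF u] by blast
    have "card {i \<in> {1..n}. (x, y) \<in> u i} \<le> card {i \<in> {1..n}. (y, x) \<in> u i}"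
      using that(1) by (simp add: majority_relation_def)
    then have "card {1..n} \<le> card ({} :: nat set)" by (simp only: P Q)
    then show False using \<open>n > 0\<close> by simp
  qed
  have stay_out: "x \<notin> S" if "(y, x) \<in> ?M\<^sup>+" "y \<notin> S" for x y
    using that by (induction rule: trancl_induct) (auto dest: no_up)
  show ?thesis
  proof
    show "top_cycle X n u \<subseteq> S"
    proof
      fix y assume y: "y \<in> top_cycle X n u"
      obtain x where "x \<in> S" using \<open>S \<noteq> {}\<close> by blast
      with y \<open>S \<subseteq> X\<close> have "(y, x) \<in> ?M\<^sup>+" by (auto simp: top_cycle_def)
      with stay_out \<open>x \<in> S\<close> show "y \<in> S" by blast
    qed
    show "S \<subseteq> top_cycle X n u"
      using conn down \<open>S \<subseteq> X\<close> unfolding top_cycle_def by blast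
  qed
qed

text \<open>The argument must exclude whole paths, not just single steps: if \<open>t\<close> does not weakly beat \<open>s\<close>
  then the only majority predecessor of \<open>s\<close> is \<open>s\<close> itself, and this property
  propagates backwards along paths.\<close>
lemma top_cycle_not_pair:
  assumes u: "u \<in> profiles X n" and "odd n" and T: "top_cycle X n u = {x, y}" and "x \<noteq> y"
  shows False
proof -
  let ?M = "majority_relation X n u"
  have no_strict: "(t, s) \<in> ?M" if T': "top_cycle X n u = {s, t}" and "s \<noteq> t" for s t
  proof (rule ccontr)
    assume not: "(t, s) \<notin> ?M"
    have reach: "(s, z) \<in> ?M\<^sup>+" if "z \<in> X" for z
      
    proof -
      have "s \<in> top_cycle X n u" by (simp add: T')
      then show ?thesis using that by (simp add: top_cycle_def)
    qed
    have only: "z = s" if "(z, s) \<in> ?M" for z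
    proof -
      have "z \<in> X" using that by (simp add: majority_relation_def)
      then have "z \<in> top_cycle X n u"
        unfolding top_cycle_def using that reach by (blast intro: trancl_into_trancl2)
      then have "z \<in> {s, t}" by (simp only: T')
      then show ?thesis using not that by blast
    qed
    have "z = s" if "(z, s) \<in> ?M\<^sup>+" for z
      using that by (induction rule: converse_trancl_induct) (auto dest: only)
    moreover have "(t, s) \<in> ?M\<^sup>+"
    proof -
      have "s \<in> top_cycle X n u" "t \<in> top_cycle X n u" by (simp_all add: T')
      then show ?thesis by (simp add: top_cycle_def)
    qed
    ultimately show False using \<open>s \<noteq> t\<close> by blast
  qed
  have "(y, x) \<in> ?M" using no_strict T \<open>x \<noteq> y\<close> by blast
  moreover have "(x, y) \<in> ?M" using no_strict[of y x] T \<open>x \<noteq> y\<close> by (simp add: insert_commute)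
  moreover have "{x, y} \<subseteq> X" unfolding T[symmetric] by (auto simp: top_cycle_def)
  ultimately show False using odd_majority_antisym[OF u \<open>odd n\<close>] \<open>x \<noteq> y\<close> by blast
qed

section \<open>Profiles realising a given top cycle\<close>

lemma singleton_in_range:
  assumes "finite X" and "n > 0" and "a \<in> X"
  shows "{a} \<in> top_cycle_range X n"
proof -
  obtain e :: "'a \<Rightarrow> int" where e: "inj_on e X"
    using finite_imp_int_inj[OF \<open>finite X\<close>] .
  define P where "P = block_order X (\<lambda>x. if x = a then 0 else 1) e"
  define u where "u = restrict (\<lambda>_. P) {1..n}"
  have u: "u \<in> profiles X n"
    unfolding u_def P_def by (intro restrict_in_profiles block_order_strong e)
  have "top_cycle X n u = {a}"
  proof (rule top_cycle_eqI[OF u \<open>n > 0\<close>])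
    show "(x, y) \<in> u i" if "i \<in> {1..n}" "x \<in> {a}" "y \<in> X - {a}" for i x y
      using that \<open>a \<in> X\<close> by (auto simp: u_def P_def block_order_def)
  qed (use \<open>a \<in> X\<close> in \<open>auto intro: majority_reflexive\<close>)
  with u show ?thesis by (auto simp: top_cycle_range_def)
qed

lemma even_in_range:
  assumes "finite X" and "even n" "n > 0" and "S \<subseteq> X" "S \<noteq> {}"
  shows "S \<in> top_cycle_range X n"
proof -
  obtain k where n: "n = 2 * k" using \<open>even n\<close> by blast
  obtain e :: "'a \<Rightarrow> int" where e: "inj_on e X"
    using finite_imp_int_inj[OF \<open>finite X\<close>] .
  then have e': "inj_on (\<lambda>x. - e x) X" by (simp add: inj_on_def)
  define p where "p = (\<lambda>x. if x \<in> S then 0 else 1 :: nat)"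
  define u where
    "u = restrict (\<lambda>i. if i \<le> k then block_order X p e else block_order X p (\<lambda>x. - e x)) {1..n}"
  have u: "u \<in> profiles X n"
    unfolding u_def by (intro restrict_in_profiles) (simp add: block_order_strong e e')
  have "top_cycle X n u = S"
  proof (rule top_cycle_eqI[OF u \<open>n > 0\<close> \<open>S \<subseteq> X\<close> \<open>S \<noteq> {}\<close>])
    show "(x, y) \<in> u i" if "i \<in> {1..n}" "x \<in> S" "y \<in> X - S" for i x y
      using that \<open>S \<subseteq> X\<close> by (auto simp: u_def p_def block_order_def)
  next
    fix x y assume xy: "x \<in> S" "y \<in> S"
    then have X: "x \<in> X" "y \<in> X" using \<open>S \<subseteq> X\<close> by auto
    consider "x = y" | "e x < e y" | "e y < e x"
      using e X by (metis inj_onD linorder_neqE_linordered_idom)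
    then have "(x, y) \<in> majority_relation X n u"
    proof cases
      case 1
      then show ?thesis using X by (simp add: majority_reflexive)
    next
      case 2
      show ?thesis
        by (rule majorityI[OF u X, of "{1..k}"])
          (use 2 xy X in \<open>auto simp: n u_def p_def block_order_def\<close>)
    next
      case 3
      show ?thesis
        by (rule majorityI[OF u X, of "{k+1..n}"])
          (use 3 xy X in \<open>auto simp: n u_def p_def block_order_def\<close>)
    qed
    then show "(x, y) \<in> (majority_relation X n u)\<^sup>+" by blast
  qed
  with u show ?thesis by (auto simp: top_cycle_range_def)
qed

text \<open>The group sizes \<open>k\<close>, \<open>k\<close>, \<open>1\<close> are chosen so that the majority of the \<open>2 * k + 1\<close>
  voters agrees with the majority of the three types.\<close>
lemma odd_in_range:
  assumes "finite X" and "odd n" "n \<ge> 2" and "S \<subseteq> X" and "card S \<ge> 3"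
  shows "S \<in> top_cycle_range X n"
proof -
  obtain k where n: "n = 2 * k + 1" using \<open>odd n\<close> by (auto elim: oddE)
  with \<open>n \<ge> 2\<close> have k: "k > 0" by simp
  obtain e :: "'a \<Rightarrow> int" where e: "inj_on e X"
    using finite_imp_int_inj[OF \<open>finite X\<close>] .
  obtain a b c where abc: "a \<in> S" "b \<in> S" "c \<in> S" "a \<noteq> b" "c \<noteq> a" "c \<noteq> b"
  proof -
    obtain T where "T \<subseteq> S" "card T = 3" using \<open>card S \<ge> 3\<close> by (rule obtain_subset_with_card_n)
    moreover then obtain x y z where "T = {x, y, z}" "x \<noteq> y" "y \<noteq> z" "x \<noteq> z"
      by (auto simp: card_3_iff)
    ultimately show thesis by (intro that[of x y z]) auto
  qed
  \<comment> \<open>Block number 3 holds the alternatives outside \<open>S\<close>, which every voter ranks last.\<close>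
  define blocks where "blocks = (\<lambda>i j l x.
    if x = a then i else if x = b then j else if x \<in> S then l else 3 :: nat)"
  define P where "P = block_order X (blocks 0 1 2) e"
  define Q where "Q = block_order X (blocks 1 2 0) e"
  define W where "W = block_order X (blocks 2 0 1) e"
  note defs = P_def Q_def W_def block_order_def blocks_def
  define u where
    "u = restrict (\<lambda>i. if i \<le> k then P else if i \<le> 2 * k then Q else W) {1..n}"
  have u: "u \<in> profiles X n"
    unfolding u_def
    by (intro restrict_in_profiles) (simp add: P_def Q_def W_def block_order_strong e)
  let ?M = "majority_relation X n u"
  have PQ: "(x, y) \<in> ?M" if "(x, y) \<in> P" "(x, y) \<in> Q" for x y
    by (rule majorityI[OF u, of _ _ "{1..2*k}"])
      (use that k in \<open>auto simp: n u_def P_def block_order_def\<close>)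
  have QW: "(x, y) \<in> ?M" if "(x, y) \<in> Q" "(x, y) \<in> W" for x y
    by (rule majorityI[OF u, of _ _ "{k+1..n}"])
      (use that k in \<open>auto simp: n u_def Q_def block_order_def\<close>)
  have PW: "(x, y) \<in> ?M" if "(x, y) \<in> P" "(x, y) \<in> W" for x y
    by (rule majorityI[OF u, of _ _ "insert n {1..k}"])
      (use that k in \<open>auto simp: n u_def P_def block_order_def\<close>)
  have ab: "(a, b) \<in> ?M"
    by (rule PQ) (use abc \<open>S \<subseteq> X\<close> in \<open>auto simp: defs\<close>)
  have bC: "(b, z) \<in> ?M" if "z \<in> S - {a, b}" for z
    by (rule PW) (use abc \<open>S \<subseteq> X\<close> that in \<open>auto simp: defs\<close>)
  have Ca: "(z, a) \<in> ?M" if "z \<in> S - {a, b}" for z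
    by (rule QW) (use abc \<open>S \<subseteq> X\<close> that in \<open>auto simp: defs\<close>)
  have from_a: "(a, z) \<in> ?M\<^sup>+" if "z \<in> S" for z
  proof -
    have "(a, a) \<in> ?M" using abc \<open>S \<subseteq> X\<close> by (auto intro: majority_reflexive)
    then show ?thesis using ab bC[of z] that by (cases "z = a \<or> z = b") auto
  qed
  have to_a: "(z, a) \<in> ?M\<^sup>+" if "z \<in> S" for z
  proof -
    \<comment> \<open>The third element is needed to return from \<open>b\<close> to \<open>a\<close>.\<close>
    have "(b, a) \<in> ?M\<^sup>+" using bC[of c] Ca[of c] abc by auto
    then show ?thesis using from_a[of a] Ca[of z] that by (cases "z = a \<or> z = b") auto
  qed
  have "top_cycle X n u = S"
  proof (rule top_cycle_eqI[OF u _ \<open>S \<subseteq> X\<close>])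
    show "(x, y) \<in> u i" if "i \<in> {1..n}" "x \<in> S" "y \<in> X - S" for i x y
      using that abc \<open>S \<subseteq> X\<close> by (auto simp: u_def defs)
    show "(x, y) \<in> ?M\<^sup>+" if "x \<in> S" "y \<in> S" for x y
      using to_a[OF that(1)] from_a[OF that(2)] by (rule trancl_trans)
  qed (use n abc in auto)
  with u show ?thesis by (auto simp: top_cycle_range_def)
qed

section \<open>The range of the top cycle correspondence\<close>

theorem mainTheorem5:
  fixes X :: "'a set" and n :: nat
  assumes "finite X" and "card X \<ge> 3" and "n \<ge> 2"
  shows "(odd n \<longrightarrow>
            (\<forall>S. S \<subseteq> X \<and> card S = 1 \<longrightarrow> S \<in> top_cycle_range X n) \<and>
            (\<forall>S. S \<subseteq> X \<and> card S = 2 \<longrightarrow> S \<notin> top_cycle_range X n) \<and>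
            (\<forall>S. S \<subseteq> X \<and> card S \<ge> 3 \<longrightarrow> S \<in> top_cycle_range X n)) \<and>
         (even n \<longrightarrow>
            (\<forall>S. S \<subseteq> X \<and> S \<noteq> {} \<longrightarrow> S \<in> top_cycle_range X n))"
proof (intro conjI impI allI)
  fix S assume "odd n" "S \<subseteq> X \<and> card S = 1"
  then show "S \<in> top_cycle_range X n"
    using singleton_in_range[OF assms(1), of n] assms(3)
    by (auto elim!: card_1_singletonE simp del: One_nat_def)
next
  fix S assume "odd n" "S \<subseteq> X \<and> card S = 2"
  then obtain x y where "S = {x, y}" "x \<noteq> y" by (auto simp: card_2_iff)
  with \<open>odd n\<close> show "S \<notin> top_cycle_range X n"
    unfolding top_cycle_range_def by (blast dest: sym intro: top_cycle_not_pair)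
next
  fix S assume "odd n" "S \<subseteq> X \<and> card S \<ge> 3"
  then show "S \<in> top_cycle_range X n" using odd_in_range assms by blast
next
  fix S assume "even n" "S \<subseteq> X \<and> S \<noteq> {}"
  then show "S \<in> top_cycle_range X n" using assms
    by (intro even_in_range) auto
qed

end
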